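(* Let $\mathbb{k}$ be an algebraically closed field, let $p,q\in\mathbb{k}^*$ with $pq\neq1$ be primitive $m$-th and $n$-th roots of unity, respectively, and let $l=\operatorname{lcm}(m,n)$. For every $(\mu,\lambda,\gamma)\in(\mathbb{k}^* )^3$, the right $\mathcal{H}_{p,q}$-module $\mathcal{V}_1(\mu,\lambda,\gamma)$ is a simple module of dimension $l$.
   Context: For $p,q\in\mathbb{k}^*=\mathbb{k}\setminus\{0\}$, $\mathcal{H}_{p,q}$ is the $\mathbb{k}$-algebra generated by $x,y,z$ subject to the relations $zx=p^{-1}xz$, $zy=pyz$, $yx-qxy=z$. All modules are right modules. $\mathcal{V}_1(\mu,\lambda,\gamma)$ is the $\mathbb{k}$-vector space with basis $\{v_k\mid 0\le k\le l-1\}$ and right $\mathcal{H}_{p,q}$-module structure given by $$v_kz=p^k\lambda v_k,\qquad v_kx=\begin{cases}\mu v_{k+1},&0\le k\le l-2\\ \mu v_0,&k=l-1,\end{cases}$$ $$v_ky=\begin{cases}\mu^{-1}q^{-k}\dfrac{pq\gamma-(pq)^k\lambda}{pq-1}v_{k-1},&1\le k\le l-1\\[2mm] \mu^{-1}\dfrac{pq\gamma-\lambda}{pq-1}v_{l-1},&k=0.\end{cases}$$ *)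

theory Defs
  imports "HOL-Library.Poly_Mapping" "HOL-Algebra.QuotRing"
    "HOL-Computational_Algebra.Polynomial"
begin

definition primitive_root_of_unity :: "nat \<Rightarrow> 'k::field \<Rightarrow> bool" where
  "primitive_root_of_unity n a \<longleftrightarrow> 0 < n \<and> a ^ n = 1 \<and> (\<forall>j. 0 < j \<and> j < n \<longrightarrow> a ^ j \<noteq> 1)"

text \<open>As in the record \<open>module\<close> of \<open>HOL-Algebra\<close>, the \<open>mult\<close> and \<open>one\<close> fields inherited from
  \<open>ring\<close> play no role.\<close>

record ('r, 'v) right_mod = "'v ring" +
  ract :: "'v \<Rightarrow> 'r \<Rightarrow> 'v" (infixl "\<lhd>\<index>" 70)

locale right_module = R: ring R + M: abelian_group M
  for R (structure) and M :: "('r, 'v, 'm) right_mod_scheme" (structure) +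
  assumes ract_closed: "\<lbrakk>v \<in> carrier M; a \<in> carrier R\<rbrakk> \<Longrightarrow> v \<lhd>\<^bsub>M\<^esub> a \<in> carrier M"
    and ract_add_left: "\<lbrakk>v \<in> carrier M; w \<in> carrier M; a \<in> carrier R\<rbrakk> \<Longrightarrow>
          (v \<oplus>\<^bsub>M\<^esub> w) \<lhd>\<^bsub>M\<^esub> a = (v \<lhd>\<^bsub>M\<^esub> a) \<oplus>\<^bsub>M\<^esub> (w \<lhd>\<^bsub>M\<^esub> a)"
    and ract_add_right: "\<lbrakk>v \<in> carrier M; a \<in> carrier R; b \<in> carrier R\<rbrakk> \<Longrightarrow>
          v \<lhd>\<^bsub>M\<^esub> (a \<oplus>\<^bsub>R\<^esub> b) = (v \<lhd>\<^bsub>M\<^esub> a) \<oplus>\<^bsub>M\<^esub> (v \<lhd>\<^bsub>M\<^esub> b)"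
    and ract_mult: "\<lbrakk>v \<in> carrier M; a \<in> carrier R; b \<in> carrier R\<rbrakk> \<Longrightarrow>
          v \<lhd>\<^bsub>M\<^esub> (a \<otimes>\<^bsub>R\<^esub> b) = (v \<lhd>\<^bsub>M\<^esub> a) \<lhd>\<^bsub>M\<^esub> b"
    and ract_one: "v \<in> carrier M \<Longrightarrow> v \<lhd>\<^bsub>M\<^esub> \<one>\<^bsub>R\<^esub> = v"

text \<open>\<open>R\<close> is only a ring; when it is a $k$-algebra the $k$-space structure on \<open>M\<close> is the one
  obtained by restriction along the structure map. For the module below this is \<open>V1_ract_scalar\<close>.\<close>

definition right_submodule ::
    "'v set \<Rightarrow> ('r, 's) ring_scheme \<Rightarrow> ('r, 'v, 'm) right_mod_scheme \<Rightarrow> bool" where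
  "right_submodule N R M \<longleftrightarrow> additive_subgroup N M \<and>
     (\<forall>v\<in>N. \<forall>a\<in>carrier R. v \<lhd>\<^bsub>M\<^esub> a \<in> N)"

locale simple_right_module = right_module +
  assumes nonzero: "carrier M \<noteq> {\<zero>\<^bsub>M\<^esub>}"
    and simple: "right_submodule N R M \<Longrightarrow> N = {\<zero>\<^bsub>M\<^esub>} \<or> N = carrier M"

definition scale :: "'k::field \<Rightarrow> ('a \<Rightarrow>\<^sub>0 'k) \<Rightarrow> ('a \<Rightarrow>\<^sub>0 'k)" where
  "scale c v = Poly_Mapping.map (\<lambda>a. c * a) v"

lemma lookup_scale [simp]: "Poly_Mapping.lookup (scale c v) k = c * Poly_Mapping.lookup v k"
  by (simp add: scale_def Poly_Mapping.map.rep_eq when_def)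

global_interpretation fs: vector_space scale
  by unfold_locales (auto intro!: poly_mapping_eqI simp: lookup_add algebra_simps)

text \<open>Linear extension: the basis vector indexed by \<open>k\<close> is sent to \<open>b k\<close>.\<close>

definition lin_ext :: "('a \<Rightarrow> 'b \<Rightarrow>\<^sub>0 'k::field) \<Rightarrow> ('a \<Rightarrow>\<^sub>0 'k) \<Rightarrow> ('b \<Rightarrow>\<^sub>0 'k)" where
  "lin_ext b v = (\<Sum>k\<in>Poly_Mapping.keys v. scale (Poly_Mapping.lookup v k) (b k))"

datatype gen = GX | GY | GZ

text \<open>Words get their own type because the convolution product on \<open>\<Rightarrow>\<^sub>0\<close> is taken with respect to
  the additively written monoid of exponents, here concatenation.\<close>

datatype word = Word (letters: "gen list")

instantiation word :: monoid_add
begin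

definition "0 = Word []"

definition "u + w = Word (letters u @ letters w)"

instance
  by standard (auto simp: zero_word_def plus_word_def)

end

definition free_alg :: "(word \<Rightarrow>\<^sub>0 'k::field) ring" where
  "free_alg = \<lparr>carrier = UNIV, monoid.mult = (*), one = 1, zero = 0, add = (+)\<rparr>"

definition var :: "gen \<Rightarrow> (word \<Rightarrow>\<^sub>0 'k::field)" where
  "var g = Poly_Mapping.single (Word [g]) 1"

definition H_relators :: "'k::field \<Rightarrow> 'k \<Rightarrow> (word \<Rightarrow>\<^sub>0 'k) set" where
  "H_relators p q =
     {var GZ * var GX - scale (inverse p) (var GX * var GZ),
      var GZ * var GY - scale p (var GY * var GZ),
      var GY * var GX - scale q (var GX * var GY) - var GZ}"

definition H_ideal :: "'k::field \<Rightarrow> 'k \<Rightarrow> (word \<Rightarrow>\<^sub>0 'k) set" where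
  "H_ideal p q = genideal free_alg (H_relators p q)"

definition H_alg :: "'k::field \<Rightarrow> 'k \<Rightarrow> (word \<Rightarrow>\<^sub>0 'k) set ring" where
  "H_alg p q = free_alg Quot H_ideal p q"

text \<open>The class of \<open>f\<close>; the structure map of the $k$-algebra \<open>H_alg p q\<close> is
  \<open>\<lambda>c. H_class p q (scale c 1)\<close>.\<close>

definition H_class :: "'k::field \<Rightarrow> 'k \<Rightarrow> (word \<Rightarrow>\<^sub>0 'k) \<Rightarrow> (word \<Rightarrow>\<^sub>0 'k) set" where
  "H_class p q f = H_ideal p q +>\<^bsub>free_alg\<^esub> f"

definition vb :: "nat \<Rightarrow> (nat \<Rightarrow>\<^sub>0 'k::field)" where
  "vb k = Poly_Mapping.single k 1"

context
  fixes p q :: "'k::field" and l :: nat and \<mu> lam \<gamma> :: 'k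
begin

text \<open>Only the values for \<open>k < l\<close> are relevant.\<close>

fun gen_act_basis :: "gen \<Rightarrow> nat \<Rightarrow> (nat \<Rightarrow>\<^sub>0 'k)" where
  "gen_act_basis GZ k = scale (p ^ k * lam) (vb k)"
| "gen_act_basis GX k = (if k < l - 1 then scale \<mu> (vb (k + 1)) else scale \<mu> (vb 0))"
| "gen_act_basis GY k =
     (if 1 \<le> k
      then scale (inverse \<mu> * inverse q ^ k * ((p * q * \<gamma> - (p * q) ^ k * lam) / (p * q - 1))) (vb (k - 1))
      else scale (inverse \<mu> * ((p * q * \<gamma> - lam) / (p * q - 1))) (vb (l - 1)))"

definition gen_act :: "gen \<Rightarrow> (nat \<Rightarrow>\<^sub>0 'k) \<Rightarrow> (nat \<Rightarrow>\<^sub>0 'k)" where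
  "gen_act g = lin_ext (gen_act_basis g)"

text \<open>The leftmost letter acts first.\<close>

definition word_act :: "(nat \<Rightarrow>\<^sub>0 'k) \<Rightarrow> word \<Rightarrow> (nat \<Rightarrow>\<^sub>0 'k)" where
  "word_act v w = fold gen_act (letters w) v"

definition free_act :: "(nat \<Rightarrow>\<^sub>0 'k) \<Rightarrow> (word \<Rightarrow>\<^sub>0 'k) \<Rightarrow> (nat \<Rightarrow>\<^sub>0 'k)" where
  "free_act v = lin_ext (word_act v)"

text \<open>A class acts through a chosen representative. For $p^l = q^l = 1$, $pq \<noteq> 1$, the choice does not
  matter (\<open>V1_ract_class\<close>), and the generators act by the prescribed formulas (\<open>V1_ract_var\<close>).\<close>

definition V1 :: "((word \<Rightarrow>\<^sub>0 'k) set, nat \<Rightarrow>\<^sub>0 'k) right_mod" where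
  "V1 = \<lparr>carrier = {v. Poly_Mapping.keys v \<subseteq> {..<l}}, monoid.mult = undefined, one = undefined,
         zero = 0, add = (+), ract = \<lambda>v a. free_act v (SOME f. f \<in> a)\<rparr>"

end

lemma lin_ext_superset:
  assumes "finite S" "Poly_Mapping.keys v \<subseteq> S"
  shows "lin_ext b v = (\<Sum>k\<in>S. scale (Poly_Mapping.lookup v k) (b k))"
  unfolding lin_ext_def using assms
  by (intro sum.mono_neutral_left) (auto simp: in_keys_iff)

lemma lin_ext_add: "lin_ext b (v + w) = lin_ext b v + lin_ext b w"
proof -
  let ?S = "Poly_Mapping.keys v \<union> Poly_Mapping.keys w"
  have "lin_ext b (v + w) = (\<Sum>k\<in>?S. scale (Poly_Mapping.lookup (v + w) k) (b k))"
    by (rule lin_ext_superset) (auto dest: Poly_Mapping.keys_add[THEN subsetD])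
  then show ?thesis
    by (simp add: lin_ext_superset[of ?S v] lin_ext_superset[of ?S w]
        lookup_add fs.scale_left_distrib sum.distrib)
qed

lemma lin_ext_scale: "lin_ext b (scale c v) = scale c (lin_ext b v)"
proof -
  have "Poly_Mapping.keys (scale c v) \<subseteq> Poly_Mapping.keys v"
    by (auto simp: in_keys_iff)
  then have "lin_ext b (scale c v) = (\<Sum>k\<in>Poly_Mapping.keys v. scale (Poly_Mapping.lookup (scale c v) k) (b k))"
    by (intro lin_ext_superset) auto
  then show ?thesis
    by (simp add: lin_ext_def fs.scale_sum_right)
qed

lemma lin_ext_zero [simp]: "lin_ext b 0 = 0"
  by (simp add: lin_ext_def)

lemma lin_ext_minus: "lin_ext b (v - w) = lin_ext b v - lin_ext b w"
  using lin_ext_add[of b "v - w" w] by (simp add: algebra_simps)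

lemma lin_ext_single [simp]: "lin_ext b (Poly_Mapping.single k c) = scale c (b k)"
  by (cases "c = 0") (simp_all add: lin_ext_def)

lemma lookup_vb: "Poly_Mapping.lookup (vb k) j = (if j = k then 1 else 0)"
  by (simp add: vb_def lookup_single when_def)

lemma lin_ext_fun_add: "lin_ext (\<lambda>k. b k + b' k) v = lin_ext b v + lin_ext b' v"
  by (simp add: lin_ext_def fs.scale_right_distrib sum.distrib)

lemma lin_ext_fun_scale: "lin_ext (\<lambda>k. scale c (b k)) v = scale c (lin_ext b v)"
  by (simp add: lin_ext_def fs.scale_sum_right mult.commute)

lemma scale_single: "scale c (Poly_Mapping.single k d) = Poly_Mapping.single k (c * d)"
  by (rule poly_mapping_eqI) (simp add: lookup_single when_def)

lemma sum_singles:
  "v = (\<Sum>k\<in>Poly_Mapping.keys v. Poly_Mapping.single k (Poly_Mapping.lookup v k))"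
proof (rule poly_mapping_eqI)
  fix j
  have "(\<Sum>k\<in>Poly_Mapping.keys v. Poly_Mapping.lookup (Poly_Mapping.single k (Poly_Mapping.lookup v k)) j) =
        (\<Sum>k\<in>Poly_Mapping.keys v. if k = j then Poly_Mapping.lookup v k else 0)"
    by (intro sum.cong) (auto simp: lookup_single when_def)
  also have "\<dots> = Poly_Mapping.lookup v j"
    by (subst sum.delta) (auto simp: in_keys_iff)
  finally show "Poly_Mapping.lookup v j =
      Poly_Mapping.lookup (\<Sum>k\<in>Poly_Mapping.keys v. Poly_Mapping.single k (Poly_Mapping.lookup v k)) j"
    by (simp add: lookup_sum)
qed

lemma single_add_induct [case_names single add]:
  fixes v :: "'a \<Rightarrow>\<^sub>0 'b::comm_monoid_add"
  assumes "\<And>k c. P (Poly_Mapping.single k c)"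
    and "\<And>v w. \<lbrakk>P v; P w\<rbrakk> \<Longrightarrow> P (v + w)"
  shows "P v"
proof -
  have "finite S \<Longrightarrow> P (\<Sum>k\<in>S. Poly_Mapping.single k (c k))" for S and c
  proof (induction S rule: finite_induct)
    case empty
    then show ?case using assms(1)[of undefined 0] by simp
  qed (simp_all add: assms)
  then have "P (\<Sum>k\<in>Poly_Mapping.keys v. Poly_Mapping.single k (Poly_Mapping.lookup v k))"
    by simp
  then show ?thesis
    by (simp only: sum_singles[symmetric])
qed

lemma ring_free_alg: "ring (free_alg :: (word \<Rightarrow>\<^sub>0 'k::field) ring)"
proof (rule ringI)
  show "abelian_group (free_alg :: (word \<Rightarrow>\<^sub>0 'k) ring)"
    by (rule abelian_groupI) (auto simp: free_alg_def algebra_simps intro: exI[of _ "- _"])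
  show "monoid (free_alg :: (word \<Rightarrow>\<^sub>0 'k) ring)"
    by (rule monoidI) (auto simp: free_alg_def algebra_simps)
qed (auto simp: free_alg_def algebra_simps)

context
  fixes p q :: "'k::field" and l :: nat and \<mu> lam \<gamma> :: 'k
begin

private abbreviation (input) "ga \<equiv> gen_act p q l \<mu> lam \<gamma>"
private abbreviation (input) "wa \<equiv> word_act p q l \<mu> lam \<gamma>"
private abbreviation (input) "fa \<equiv> free_act p q l \<mu> lam \<gamma>"
private abbreviation (input) "V \<equiv> V1 p q l \<mu> lam \<gamma>"

lemma fold_ga_add: "fold ga xs (v + w) = fold ga xs v + fold ga xs w"
  by (induction xs arbitrary: v w) (simp_all add: gen_act_def lin_ext_add)

lemma fold_ga_scale: "fold ga xs (scale c v) = scale c (fold ga xs v)"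
  by (induction xs arbitrary: v) (simp_all add: gen_act_def lin_ext_scale)

lemma free_act_add_left: "fa (v + w) f = fa v f + fa w f"
  by (simp add: free_act_def word_act_def[abs_def] fold_ga_add lin_ext_fun_add)

lemma free_act_scale_left: "fa (scale c v) f = scale c (fa v f)"
  by (simp add: free_act_def word_act_def[abs_def] fold_ga_scale lin_ext_fun_scale)

lemma free_act_zero_left: "fa 0 f = 0"
  using free_act_scale_left[of 0 0 f] by simp

lemma free_act_add_right: "fa v (f + g) = fa v f + fa v g"
  by (simp add: free_act_def lin_ext_add)

lemma free_act_zero_right: "fa v 0 = 0"
  by (simp add: free_act_def)

lemma free_act_minus_right: "fa v (f - g) = fa v f - fa v g"
  by (simp add: free_act_def lin_ext_minus)

lemma free_act_scale_right: "fa v (scale c f) = scale c (fa v f)"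
  by (simp add: free_act_def lin_ext_scale)

lemma free_act_one: "fa v 1 = v"
  by (simp add: free_act_def word_act_def zero_word_def flip: single_one)

lemma free_act_var: "fa v (var g) = ga g v"
  by (simp add: free_act_def word_act_def var_def)

lemma free_act_mult: "fa v (f * g) = fa (fa v f) g"
proof (induction f rule: single_add_induct)
  case (single u c)
  show ?case
  proof (induction g rule: single_add_induct)
    case (single w d)
    show ?case
      by (simp add: mult_single free_act_def word_act_def plus_word_def fold_ga_scale
          mult.commute)
  next
    case (add f g)
    then show ?case by (simp add: distrib_left free_act_add_right)
  qed
next
  case (add f g)
  then show ?case by (simp add: distrib_right free_act_add_left free_act_add_right)
qed

lemma gen_act_vb: "ga g (vb k) = gen_act_basis p q l \<mu> lam \<gamma> g k"
  by (simp add: gen_act_def vb_def)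

lemma V_expand: "v = (\<Sum>k\<in>Poly_Mapping.keys v. scale (Poly_Mapping.lookup v k) (vb k))"
  unfolding vb_def scale_single mult_1_right by (rule sum_singles)

lemma V_linear_zero:
  assumes v: "v \<in> carrier V" and z: "\<And>k. k < l \<Longrightarrow> fa (vb k) f = 0"
  shows "fa v f = 0"
proof -
  have S: "finite S \<Longrightarrow> S \<subseteq> {..<l} \<Longrightarrow> fa (\<Sum>k\<in>S. scale (h k) (vb k)) f = 0" for S h
    by (induction S rule: finite_induct)
      (auto simp: free_act_zero_left free_act_add_left free_act_scale_left z)
  have "fa (\<Sum>k\<in>Poly_Mapping.keys v. scale (Poly_Mapping.lookup v k) (vb k)) f = 0"
    using v by (intro S) (auto simp: V1_def)
  then show ?thesis
    by (simp only: V_expand[symmetric])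
qed

context
  assumes p: "p \<noteq> 0" and q: "q \<noteq> 0" and \<mu>: "\<mu> \<noteq> 0" and pq: "p * q \<noteq> 1" and l: "0 < l"
    and pl: "p ^ l = 1" and ql: "q ^ l = 1"
begin

lemma gen_act_basis_carrier: "k < l \<Longrightarrow> gen_act_basis p q l \<mu> lam \<gamma> g k \<in> carrier V"
  using l by (cases g) (auto simp: V1_def in_keys_iff lookup_vb split: if_splits)

lemma V_add: "\<lbrakk>v \<in> carrier V; w \<in> carrier V\<rbrakk> \<Longrightarrow> v + w \<in> carrier V"
  by (auto simp: V1_def dest!: Poly_Mapping.keys_add[THEN subsetD])

lemma V_scale: "v \<in> carrier V \<Longrightarrow> scale c v \<in> carrier V"
  by (auto simp: V1_def in_keys_iff subset_iff)

lemma V_sum: "(\<And>k. k \<in> S \<Longrightarrow> h k \<in> carrier V) \<Longrightarrow> sum h S \<in> carrier V"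
  by (induction S rule: infinite_finite_induct) (auto intro!: V_add, auto simp: V1_def)

lemma gen_act_carrier: "v \<in> carrier V \<Longrightarrow> ga g v \<in> carrier V"
  unfolding gen_act_def lin_ext_def
  by (intro V_sum V_scale gen_act_basis_carrier) (auto simp: V1_def)

lemma free_act_carrier: "v \<in> carrier V \<Longrightarrow> fa v f \<in> carrier V"
proof -
  have "w \<in> carrier V \<Longrightarrow> fold ga xs w \<in> carrier V" for xs w
    by (induction xs arbitrary: w) (auto simp: gen_act_carrier)
  then show "v \<in> carrier V \<Longrightarrow> fa v f \<in> carrier V"
    unfolding free_act_def lin_ext_def word_act_def by (intro V_sum V_scale) auto
qed

lemma ga_scale: "ga g (scale c v) = scale c (ga g v)"
  by (simp add: gen_act_def lin_ext_scale)

lemma relators_act_zero: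
  assumes v: "v \<in> carrier V" and f: "f \<in> H_relators p q"
  shows "fa v f = 0"
proof (rule V_linear_zero[OF v])
  fix k assume k: "k < l"
  have pq': "p * q - 1 \<noteq> 0" using pq by simp
  have zx: "ga GX (ga GZ (vb k)) = scale (inverse p) (ga GZ (ga GX (vb k)))"
  proof (cases "k < l - 1")
    case True
    then show ?thesis using p by (simp add: ga_scale gen_act_vb ac_simps)
  next
    case False
    then have "l = Suc k" using k by simp
    then have "p * p ^ k = 1" using pl by simp
    then have "p ^ k = inverse p" using p by (simp add: field_simps)
    with False show ?thesis by (simp add: ga_scale gen_act_vb ac_simps)
  qed
  have zy: "ga GY (ga GZ (vb k)) = scale p (ga GZ (ga GY (vb k)))"
  proof (cases k)
    case 0
    have "p * p ^ (l - 1) = 1" using pl l by (simp flip: power_Suc)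
    then have "p ^ (l - 1) = inverse p" using p by (simp add: field_simps)
    then show ?thesis using 0 p by (simp add: ga_scale gen_act_vb ac_simps)
  qed (simp add: ga_scale gen_act_vb ac_simps)
  have yx: "ga GX (ga GY (vb k)) =
      scale (inverse q ^ k * ((p * q * \<gamma> - (p * q) ^ k * lam) / (p * q - 1))) (vb k)"
    using k l \<mu> by (cases k) (auto simp: ga_scale gen_act_vb)
  have xy: "ga GY (ga GX (vb k)) =
      scale (inverse q ^ Suc k * ((p * q * \<gamma> - (p * q) ^ Suc k * lam) / (p * q - 1))) (vb k)"
  proof (cases "k < l - 1")
    case True
    then show ?thesis using \<mu> by (simp add: ga_scale gen_act_vb mult.assoc)
  next
    case False
    then have "l = Suc k" using k by simp
    then have "inverse q ^ Suc k = 1" "(p * q) ^ Suc k = 1" "l - 1 = k"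
      using pl ql by (simp_all only: power_inverse power_mult_distrib) simp_all
    then show ?thesis using \<mu>
      by (simp add: ga_scale gen_act_vb del: power_Suc)
  qed
  have K: "Q * ((g - R * lam) / d) - q * (inverse q * Q * ((g - p * q * R * lam) / d)) = Q * R * lam"
    if "d = p * q - 1" for Q R d g
  proof -
    have "Q * ((g - R * lam) / d) - q * (inverse q * Q * ((g - p * q * R * lam) / d)) =
        Q * ((g - R * lam) - (g - p * q * R * lam)) / d"
    proof -
      have "q * (inverse q * Q * x) = Q * x" for x
        using q by simp
      then show ?thesis
        by (simp only: diff_divide_distrib right_diff_distrib times_divide_eq_right)
    qed
    also have "(g - R * lam) - (g - p * q * R * lam) = d * (R * lam)"
      by (simp add: that algebra_simps)
    finally show ?thesis
      using pq' by (simp add: that)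
  qed
  have Qk: "inverse q ^ k * (p * q) ^ k = p ^ k"
    using q by (simp add: power_mult_distrib power_inverse)
  have c: "inverse q ^ k * ((p * q * \<gamma> - (p * q) ^ k * lam) / (p * q - 1)) -
      q * (inverse q ^ Suc k * ((p * q * \<gamma> - (p * q) ^ Suc k * lam) / (p * q - 1))) = p ^ k * lam"
    unfolding power_Suc K[OF refl] Qk ..
  have "ga GX (ga GY (vb k)) - scale q (ga GY (ga GX (vb k))) = ga GZ (vb k)"
    unfolding xy yx unfolding gen_act_vb gen_act_basis.simps fs.scale_scale
      fs.scale_left_diff_distrib[symmetric] c ..
  with zx zy f show "fa (vb k) f = 0"
    by (auto simp: H_relators_def free_act_minus_right free_act_scale_right free_act_mult
        free_act_var)
qed

lemma ideal_act_zero: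
  assumes v: "v \<in> carrier V" and f: "f \<in> H_ideal p q"
  shows "fa v f = 0"
proof -
  interpret F: ring "free_alg :: (word \<Rightarrow>\<^sub>0 'k) ring" by (rule ring_free_alg)
  have minv: "\<ominus>\<^bsub>free_alg\<^esub> a = - a" for a :: "word \<Rightarrow>\<^sub>0 'k"
    by (rule F.minus_equality) (simp_all add: free_alg_def)
  let ?A = "{f. \<forall>v\<in>carrier V. fa v f = 0}"
  have "ideal ?A free_alg"
  proof (rule idealI[OF ring_free_alg])
    show "subgroup ?A (add_monoid free_alg)"
    proof (rule group.subgroupI)
      show "group (add_monoid (free_alg :: (word \<Rightarrow>\<^sub>0 'k) ring))" by (rule F.a_group)
      show "inv\<^bsub>add_monoid free_alg\<^esub> a \<in> ?A" if "a \<in> ?A" for a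
        using that minv[of a] free_act_minus_right[of _ 0 a]
        by (auto simp: a_inv_def free_act_zero_right)
    qed (auto simp: free_alg_def free_act_add_right free_act_zero_right intro: exI[of _ 0])
  qed (auto simp: free_alg_def free_act_mult free_act_zero_left free_act_carrier)
  moreover have "H_relators p q \<subseteq> ?A" using relators_act_zero by auto
  ultimately have "H_ideal p q \<subseteq> ?A"
    unfolding H_ideal_def by (rule F.genideal_minimal)
  then show ?thesis using v f by auto
qed

lemma V1_ract_class:
  assumes v: "v \<in> carrier V"
  shows "v \<lhd>\<^bsub>V\<^esub> (H_class p q f) = fa v f"
proof -
  interpret F: ring "free_alg :: (word \<Rightarrow>\<^sub>0 'k) ring" by (rule ring_free_alg)
  interpret I: ideal "H_ideal p q" "free_alg :: (word \<Rightarrow>\<^sub>0 'k) ring"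
    unfolding H_ideal_def by (rule F.genideal_ideal) (simp add: free_alg_def)
  have cls: "H_class p q f = {h + f |h. h \<in> H_ideal p q}"
    by (auto simp: H_class_def a_r_coset_def' free_alg_def)
  define r where "r = (SOME g. g \<in> H_class p q f)"
  have "0 + f \<in> H_class p q f"
    unfolding cls using I.zero_closed by (force simp: free_alg_def)
  then have "r \<in> H_class p q f"
    unfolding r_def by (rule someI)
  then obtain h where h: "h \<in> H_ideal p q" "r = h + f"
    unfolding cls by blast
  have "v \<lhd>\<^bsub>V\<^esub> (H_class p q f) = fa v r"
    by (simp add: V1_def r_def)
  also have "\<dots> = fa v f"
    by (simp add: h(2) free_act_add_right ideal_act_zero[OF v h(1)])
  finally show ?thesis .
qed

lemma vb_carrier: "k < l \<Longrightarrow> vb k \<in> carrier V"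
  by (simp add: V1_def vb_def)

lemma V1_ract_scalar: "v \<in> carrier V \<Longrightarrow> v \<lhd>\<^bsub>V\<^esub> (H_class p q (scale c 1)) = scale c v"
  by (simp add: V1_ract_class free_act_scale_right free_act_one)

lemma V1_ract_var:
  "k < l \<Longrightarrow> vb k \<lhd>\<^bsub>V\<^esub> (H_class p q (var g)) = gen_act_basis p q l \<mu> lam \<gamma> g k"
  by (simp add: V1_ract_class vb_carrier free_act_var gen_act_vb)

end

end

end

theory Submission
  imports Defs
begin

text \<open>
  The elements \<open>z\<close> and \<open>yx\<close> act diagonally on the basis \<open>v\<^sub>k\<close>, and since \<open>l = lcm m n\<close> and
  \<open>\<gamma>\<close> is nonzero, their joint eigenvalues separate the indices \<open>k < l\<close>. An element of minimal
  support in a nonzero submodule is therefore a multiple of some \<open>v\<^sub>k\<close>, and \<open>x\<close> permutes the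
  basis cyclically up to the nonzero factor \<open>\<mu>\<close>.
\<close>

section \<open>Exponents of roots of unity\<close>

lemma primitive_root_of_unity_dvd:
  assumes "primitive_root_of_unity n a" "a ^ j = 1"
  shows "n dvd j"
proof -
  have "a ^ j = (a ^ n) ^ (j div n) * a ^ (j mod n)"
    by (simp flip: power_mult power_add)
  then have "a ^ (j mod n) = 1"
    using assms by (simp add: primitive_root_of_unity_def)
  \<comment> \<open>The remainder is an exponent below \<open>n\<close> with power 1, so minimality
    of \<open>n\<close> makes it 0.\<close>
  then have "j mod n = 0"
    using assms(1) unfolding primitive_root_of_unity_def by (metis gr0I mod_less_divisor)
  then show ?thesis by auto
qed

lemma primitive_root_of_unity_power_eq_1:
  assumes "primitive_root_of_unity n a" "n dvd j"
  shows "a ^ j = 1"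
  using assms by (auto simp: primitive_root_of_unity_def power_mult dvd_def)

text \<open>For \<open>j \<le> k\<close>, cancelling \<open>p ^ j\<close> and \<open>q ^ j\<close>
  shows that both orders divide \<open>k - j\<close>; so does their lcm, which exceeds
  \<open>k - j\<close>.\<close>

lemma primitive_roots_of_unity_separate:
  assumes "primitive_root_of_unity m p" "primitive_root_of_unity n q"
    and "j < lcm m n" "k < lcm m n" "p ^ j = p ^ k" "q ^ j = q ^ k"
  shows "j = k"
  using assms(3-6)
proof (induction j k rule: linorder_wlog)
  case (le j k)
  have nz: "p \<noteq> 0" "q \<noteq> 0"
    using assms(1,2) by (auto simp: primitive_root_of_unity_def zero_power)
  have "p ^ k = p ^ j * p ^ (k - j)" "q ^ k = q ^ j * q ^ (k - j)"
    using le(1) by (simp_all flip: power_add)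
  then have "p ^ (k - j) = 1" "q ^ (k - j) = 1"
    using le nz by auto
  then have "lcm m n dvd k - j"
    using assms(1,2) by (auto intro: primitive_root_of_unity_dvd)
  then show ?case
    using le by (metis dvd_imp_le less_imp_diff_less linorder_not_less zero_less_diff le_neq_implies_less)
qed auto

section \<open>Computing with classes in the quotient algebra\<close>

lemma H_ideal_ideal: "ideal (H_ideal p q) free_alg"
  unfolding H_ideal_def
  by (rule ring.genideal_ideal[OF ring_free_alg]) (simp add: free_alg_def)

lemma ring_H_alg: "ring (H_alg p q)"
  unfolding H_alg_def by (rule ideal.quotient_is_ring[OF H_ideal_ideal])

text \<open>Lets statements about all elements of \<open>H_alg p q\<close> be checked on
  representatives in the free algebra.\<close>

lemma carrier_H_alg: "carrier (H_alg p q) = range (H_class p q)"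
  by (auto simp: H_alg_def FactRing_def A_RCOSETS_def' H_class_def free_alg_def)

lemma H_class_mult: "H_class p q f \<otimes>\<^bsub>H_alg p q\<^esub> H_class p q g = H_class p q (f * g)"
  using ideal.rcoset_mult_add[OF H_ideal_ideal, of f g p q]
  by (simp add: H_alg_def FactRing_def H_class_def free_alg_def)

lemma H_class_add: "H_class p q f \<oplus>\<^bsub>H_alg p q\<^esub> H_class p q g = H_class p q (f + g)"
proof -
  interpret I: ideal "H_ideal p q" free_alg by (rule H_ideal_ideal)
  show ?thesis
    using I.a_rcos_sum[of f g]
    by (simp add: H_alg_def FactRing_def H_class_def free_alg_def)
qed

lemma H_class_one: "\<one>\<^bsub>H_alg p q\<^esub> = H_class p q 1"
  by (simp add: H_alg_def FactRing_def H_class_def free_alg_def)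

section \<open>Linear extension and diagonal operators\<close>

lemma free_act_lin_ext:
  "free_act p q l \<mu> lam \<gamma> v f = lin_ext (\<lambda>k. free_act p q l \<mu> lam \<gamma> (vb k) f) v"
proof (induction v rule: single_add_induct)
  case (single k c)
  have "Poly_Mapping.single k c = scale c (vb k)"
    by (simp add: vb_def scale_single)
  then show ?case by (simp add: free_act_scale_left lin_ext_scale vb_def)
next
  case (add v w)
  then show ?case by (simp add: free_act_add_left lin_ext_add)
qed

lemma inj_vb: "inj (vb :: nat \<Rightarrow> (nat \<Rightarrow>\<^sub>0 'k::field))"
  by (rule injI) (metis lookup_vb zero_neq_one)

text \<open>\<open>lin_ext\<close> sums over the support of \<open>v\<close> only, so the diagonal
  form is needed just there. Hence eigenvalue formulas restricted to \<open>k < l\<close> apply to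
  vectors of the carrier.\<close>

lemma lookup_lin_ext_diagonal:
  assumes "\<And>k. k \<in> Poly_Mapping.keys v \<Longrightarrow> b k = scale (e k) (vb k)"
  shows "Poly_Mapping.lookup (lin_ext b v) i = e i * Poly_Mapping.lookup v i"
proof -
  have "Poly_Mapping.lookup (lin_ext b v) i =
      (\<Sum>k\<in>Poly_Mapping.keys v. if i = k then e i * Poly_Mapping.lookup v i else 0)"
    unfolding lin_ext_def lookup_sum
    by (intro sum.cong refl) (auto simp: assms lookup_vb)
  then show ?thesis by (auto simp: in_keys_iff)
qed

section \<open>Basis and dimension\<close>

context
  fixes p q :: "'k::field" and l :: nat and \<mu> lam \<gamma> :: 'k
begin

private abbreviation (input) "fa \<equiv> free_act p q l \<mu> lam \<gamma>"
private abbreviation (input) "V \<equiv> V1 p q l \<mu> lam \<gamma>"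

lemma independent_vb: "fs.independent (vb ` {..<l} :: (nat \<Rightarrow>\<^sub>0 'k) set)"
proof -
  have "c (vb k) = 0"
    if "(\<Sum>v\<in>vb ` {..<l}. scale (c v) v) = 0" "k < l" for c :: "(nat \<Rightarrow>\<^sub>0 'k) \<Rightarrow> 'k" and k
  proof -
    have "0 = (\<Sum>j<l. scale (c (vb j)) (vb j :: nat \<Rightarrow>\<^sub>0 'k))"
      using that(1) by (simp add: sum.reindex inj_on_subset[OF inj_vb])
    \<comment> \<open>Reading the vanishing combination at index \<open>k\<close> isolates the
      coefficient of \<open>vb k\<close>.\<close>
    then have "0 = Poly_Mapping.lookup (\<Sum>j<l. scale (c (vb j)) (vb j)) k"
      by (metis lookup_zero)
    also have "\<dots> = (\<Sum>j<l. if k = j then c (vb k) else 0)"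
      unfolding lookup_sum by (intro sum.cong) (auto simp: lookup_vb)
    finally show ?thesis
      using that(2) by simp
  qed
  then show ?thesis
    by (subst fs.independent_if_scalars_zero) auto
qed

lemma dim_V1: "fs.dim (carrier V) = l"
proof -
  have "v \<in> fs.span (vb ` {..<l})" if "v \<in> carrier V" for v
  proof -
    have "(\<Sum>k\<in>Poly_Mapping.keys v. scale (Poly_Mapping.lookup v k) (vb k)) \<in> fs.span (vb ` {..<l})"
      using that by (intro fs.span_sum fs.span_scale fs.span_base) (auto simp: V1_def)
    then show ?thesis by (simp only: V_expand[symmetric])
  qed
  then have "card (vb ` {..<l} :: (nat \<Rightarrow>\<^sub>0 'k) set) = fs.dim (carrier V)"
    by (intro fs.basis_card_eq_dim independent_vb) (auto simp: V1_def vb_def)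
  then show ?thesis
    by (simp add: card_image inj_on_subset[OF inj_vb])
qed

section \<open>The right module structure\<close>

context
  assumes p: "p \<noteq> 0" and q: "q \<noteq> 0" and \<mu>: "\<mu> \<noteq> 0" and pq: "p * q \<noteq> 1" and l: "0 < l"
    and pl: "p ^ l = 1" and ql: "q ^ l = 1"
begin

lemmas V1_facts =
  V1_ract_class[OF p q \<mu> pq l pl ql] free_act_carrier[OF p q \<mu> pq l pl ql]
  V_add[OF p q \<mu> pq l pl ql] V_scale[OF p q \<mu> pq l pl ql] vb_carrier[OF p q \<mu> pq l pl ql]

lemma abelian_group_V1: "abelian_group V"
proof (rule abelian_groupI)
  fix v assume v: "v \<in> carrier V"
  \<comment> \<open>Taking \<open>scale (-1) v\<close> as the additive inverse reduces its
    membership in the carrier to closure under scaling.\<close>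
  have "scale (-1) v + v = 0"
    by (rule poly_mapping_eqI) (simp add: lookup_add)
  then show "\<exists>w\<in>carrier V. w \<oplus>\<^bsub>V\<^esub> v = \<zero>\<^bsub>V\<^esub>"
    using V1_facts(4)[OF v, of "-1"] by (intro bexI[of _ "scale (-1) v"]) (auto simp: V1_def)
next
  fix v w assume "v \<in> carrier V" "w \<in> carrier V"
  then show "v \<oplus>\<^bsub>V\<^esub> w \<in> carrier V"
    using V1_facts(3)[of v lam \<gamma> w] by (simp add: V1_def)
qed (auto simp: V1_def algebra_simps)

lemma right_module_V1: "right_module (H_alg p q) V"
proof -
  interpret R: ring "H_alg p q" by (rule ring_H_alg)
  interpret M: abelian_group V by (rule abelian_group_V1)
  have add: "v \<oplus>\<^bsub>V\<^esub> w = v + w" for v w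
    by (simp add: V1_def)
  show ?thesis
    by unfold_locales
      (auto simp: carrier_H_alg H_class_mult H_class_add H_class_one add V1_facts
        free_act_add_left free_act_add_right free_act_mult free_act_one)
qed

section \<open>Joint eigenvalues of \<open>z\<close> and \<open>yx\<close>\<close>

lemma free_act_vb_z: "k < l \<Longrightarrow> fa (vb k) (var GZ) = scale (p ^ k * lam) (vb k)"
  by (simp add: free_act_var gen_act_vb)

text \<open>\<open>y\<close> lowers the index cyclically and \<open>x\<close> raises it back, their
  factors \<open>inverse \<mu>\<close> and \<open>\<mu>\<close> cancelling. At \<open>k = 0\<close>
  the path wraps through \<open>l - 1\<close>, and the same formula results because the zeroth
  powers are 1.\<close>

lemma free_act_vb_yx:
  "k < l \<Longrightarrow> fa (vb k) (var GY * var GX) =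
     scale (inverse q ^ k * ((p * q * \<gamma> - (p * q) ^ k * lam) / (p * q - 1))) (vb k)"
  using l \<mu> by (cases k) (auto simp: free_act_mult free_act_var gen_act_vb
      ga_scale[OF p q \<mu> pq l pl ql])

text \<open>Up to the factor \<open>1 / (p * q - 1)\<close>, the \<open>yx\<close>-eigenvalue is
  \<open>inverse q ^ i * (p * q * \<gamma>)\<close> minus the \<open>z\<close>-eigenvalue. Equal
  \<open>z\<close>-eigenvalues thus leave an equation between powers of \<open>q\<close>, as
  \<gamma> is nonzero; \<open>lam \<noteq> 0\<close> gives the one for \<open>p\<close>.\<close>

lemma eigenvalues_separate:
  assumes lam: "lam \<noteq> 0" and \<gamma>: "\<gamma> \<noteq> 0"
    and z: "p ^ j * lam = p ^ k * lam"
    and yx: "inverse q ^ j * ((p * q * \<gamma> - (p * q) ^ j * lam) / (p * q - 1)) =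
      inverse q ^ k * ((p * q * \<gamma> - (p * q) ^ k * lam) / (p * q - 1))"
  shows "p ^ j = p ^ k \<and> q ^ j = q ^ k"
proof -
  have e: "inverse q ^ i * ((p * q * \<gamma> - (p * q) ^ i * lam) / (p * q - 1)) =
      (inverse q ^ i * (p * q * \<gamma>) - p ^ i * lam) / (p * q - 1)" for i
    using q by (simp add: power_inverse power_mult_distrib right_diff_distrib)
  have "inverse q ^ j * (p * q * \<gamma>) - p ^ j * lam = inverse q ^ k * (p * q * \<gamma>) - p ^ k * lam"
    using yx pq unfolding e by simp
  then have "inverse q ^ j * (p * q * \<gamma>) = inverse q ^ k * (p * q * \<gamma>)"
    using z by simp
  then show ?thesis
    using p q \<gamma> lam z by (simp add: power_inverse)
qed

section \<open>Submodules and simplicity\<close>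

text \<open>Transfers the closure of \<open>N\<close> from classes to the free algebra. Closure
  under scalars follows because the algebra element \<open>scale c 1\<close> acts as multiplication
  by \<open>c\<close>.\<close>

lemma submodule_closure:
  assumes N: "right_submodule N (H_alg p q) V"
  shows "N \<subseteq> carrier V" and "0 \<in> N"
    and "\<And>v w. v \<in> N \<Longrightarrow> w \<in> N \<Longrightarrow> v + w \<in> N"
    and "\<And>v f. v \<in> N \<Longrightarrow> fa v f \<in> N"
    and "\<And>v c. v \<in> N \<Longrightarrow> scale c v \<in> N"
proof -
  interpret additive_subgroup N V
    using N by (simp add: right_submodule_def)
  show sub: "N \<subseteq> carrier V"
    by (rule a_subset)
  show "0 \<in> N"
    using zero_closed by (simp add: V1_def)
  show "v + w \<in> N" if "v \<in> N" "w \<in> N" for v w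
    using a_closed[OF that] by (simp add: V1_def)
  show act: "fa v f \<in> N" if "v \<in> N" for v f
  proof -
    have "v \<lhd>\<^bsub>V\<^esub> H_class p q f \<in> N"
      using N that by (auto simp: right_submodule_def carrier_H_alg)
    then show ?thesis
      using that sub by (simp add: V1_facts(1) subsetD)
  qed
  show "scale c v \<in> N" if "v \<in> N" for v c
    using act[OF that, of "scale c 1"] by (simp add: free_act_scale_right free_act_one)
qed

lemma submodule_eq_carrier:
  assumes N: "right_submodule N (H_alg p q) V" and vb: "vb k \<in> N" and k: "k < l"
  shows "N = carrier V"
proof -
  note closure = submodule_closure[OF N]
  have shift: "vb (if j < l - 1 then j + 1 else 0) \<in> N" if "vb j \<in> N" for j
    using closure(5)[OF closure(4)[OF that, of "var GX"], of "inverse \<mu>"] \<mu>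
    by (simp add: free_act_var gen_act_vb split: if_splits)
  have up: "i \<le> j \<Longrightarrow> j < l \<Longrightarrow> vb i \<in> N \<Longrightarrow> vb j \<in> N" for i j
  proof (induction rule: dec_induct)
    case (step j)
    then show ?case using shift[of j] by (auto split: if_splits)
  qed
  \<comment> \<open>Climb from \<open>k\<close> to the last index, wrap around once to 0, and climb
    again to reach every index.\<close>
  have "vb (l - 1) \<in> N"
    using up[of k "l - 1"] vb k by simp
  then have "vb 0 \<in> N"
    using shift[of "l - 1"] by simp
  then have all: "vb j \<in> N" if "j < l" for j
    using up[of 0 j] that by simp
  have "v \<in> N" if "v \<in> carrier V" for v
  proof -
    have "finite S \<Longrightarrow> S \<subseteq> {..<l} \<Longrightarrow> (\<Sum>k\<in>S. scale (h k) (vb k)) \<in> N" for S h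
      by (induction S rule: finite_induct) (auto simp: closure(2,3,5) all)
    from this[of "Poly_Mapping.keys v" "Poly_Mapping.lookup v"] that show ?thesis
      by (simp add: V1_def V_expand[symmetric])
  qed
  with closure(1) show ?thesis by auto
qed

lemma submodule_contains_vb:
  assumes N: "right_submodule N (H_alg p q) V" and nz: "N \<noteq> {0}"
    and lam: "lam \<noteq> 0" and \<gamma>: "\<gamma> \<noteq> 0"
    and sep: "\<And>j k. \<lbrakk>j < l; k < l; p ^ j = p ^ k; q ^ j = q ^ k\<rbrakk> \<Longrightarrow> j = k"
  shows "\<exists>k<l. vb k \<in> N"
proof -
  note closure = submodule_closure[OF N]
  obtain v where v: "v \<in> N" "v \<noteq> 0"
    and min: "\<And>w. w \<in> N \<Longrightarrow> w \<noteq> 0 \<Longrightarrow> card (Poly_Mapping.keys v) \<le> card (Poly_Mapping.keys w)"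
    using ex_has_least_nat[of "\<lambda>v. v \<in> N \<and> v \<noteq> 0" _ "\<lambda>v. card (Poly_Mapping.keys v)"] nz closure(2)
    by blast
  have keys: "Poly_Mapping.keys v \<subseteq> {..<l}"
    using v closure(1) by (auto simp: V1_def)
  \<comment> \<open>An algebra element acting diagonally has a single eigenvalue on the support of
    \<open>v\<close>; otherwise subtracting a multiple of \<open>v\<close> would contradict
    minimality.\<close>
  have eig: "e j = e k"
    if f: "\<And>i. i < l \<Longrightarrow> fa (vb i) f = scale (e i) (vb i)"
      and j: "j \<in> Poly_Mapping.keys v" and k: "k \<in> Poly_Mapping.keys v" for f e j k
  proof (rule ccontr)
    assume ne: "e j \<noteq> e k"
    \<comment> \<open>This removes the coefficient at \<open>j\<close> while keeping the one at
      \<open>k\<close>, so \<open>w\<close> is nonzero with strictly smaller support.\<close>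
    define w where "w = fa v f + scale (- e j) v"
    have "Poly_Mapping.lookup (fa v f) i = e i * Poly_Mapping.lookup v i" for i
      by (subst free_act_lin_ext, rule lookup_lin_ext_diagonal) (use f keys in auto)
    then have w: "Poly_Mapping.lookup w i = (e i - e j) * Poly_Mapping.lookup v i" for i
      by (simp only: w_def lookup_add lookup_scale) (simp add: algebra_simps)
    then have "Poly_Mapping.keys w \<subseteq> Poly_Mapping.keys v" "j \<notin> Poly_Mapping.keys w"
      and wk: "k \<in> Poly_Mapping.keys w"
      using k ne by (auto simp: in_keys_iff)
    then have "card (Poly_Mapping.keys w) < card (Poly_Mapping.keys v)"
      using j by (intro psubset_card_mono) auto
    moreover have "w \<in> N"
      unfolding w_def using v(1) by (intro closure(3-5))
    moreover have "w \<noteq> 0"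
      using wk by auto
    ultimately show False using min[of w] by simp
  qed
  \<comment> \<open>Applying \<open>eig\<close> to \<open>z\<close> and to \<open>yx\<close> makes
    both eigenvalues agree at \<open>j\<close> and \<open>k\<close>, which \<open>sep\<close>
    excludes for distinct indices.\<close>
  have single: "j = k" if jk: "j \<in> Poly_Mapping.keys v" "k \<in> Poly_Mapping.keys v" for j k
  proof -
    have "p ^ j = p ^ k \<and> q ^ j = q ^ k"
      by (rule eigenvalues_separate[OF lam \<gamma>])
        (rule eig[OF free_act_vb_z jk] eig[OF free_act_vb_yx jk]; assumption)+
    then show ?thesis using sep jk keys by auto
  qed
  obtain k where k: "k \<in> Poly_Mapping.keys v"
    using v(2) by (metis keys_eq_empty equals0I)
  then have "Poly_Mapping.keys v = {k}"
    using single by auto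
  then have "v = scale (Poly_Mapping.lookup v k) (vb k)"
    by (subst V_expand[of v]) simp
  then have "scale (inverse (Poly_Mapping.lookup v k)) v = vb k"
    using k by (metis fs.scale_scale fs.scale_one in_keys_iff left_inverse)
  then have "vb k \<in> N"
    using closure(5)[OF v(1)] by metis
  then show ?thesis using k keys by auto
qed

lemma simple_right_module_V1:
  assumes lam: "lam \<noteq> 0" and \<gamma>: "\<gamma> \<noteq> 0"
    and sep: "\<And>j k. \<lbrakk>j < l; k < l; p ^ j = p ^ k; q ^ j = q ^ k\<rbrakk> \<Longrightarrow> j = k"
  shows "simple_right_module (H_alg p q) V"
proof -
  interpret right_module "H_alg p q" V by (rule right_module_V1)
  have zero: "\<zero>\<^bsub>V\<^esub> = 0"
    by (simp add: V1_def)
  show ?thesis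
  proof unfold_locales
    \<comment> \<open>Since \<open>l\<close> is positive, index 0 is available and witnesses that
      the module is nonzero.\<close>
    have "vb 0 \<in> carrier V" "vb 0 \<noteq> (0 :: nat \<Rightarrow>\<^sub>0 'k)"
      using l V1_facts(5)[of 0] by (simp_all add: vb_def)
    then show "carrier V \<noteq> {\<zero>\<^bsub>V\<^esub>}"
      using zero by auto
  next
    fix N assume N: "right_submodule N (H_alg p q) V"
    show "N = {\<zero>\<^bsub>V\<^esub>} \<or> N = carrier V"
      using submodule_contains_vb[OF N _ lam \<gamma> sep] submodule_eq_carrier[OF N]
      unfolding zero by blast
  qed
qed

end

end

theorem theorem5p1:
  fixes p q \<mu> lam \<gamma> :: "'k::alg_closed_field" and m n l :: nat
  assumes "p \<noteq> 0" and "q \<noteq> 0" and "p * q \<noteq> 1"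
    and "primitive_root_of_unity m p" and "primitive_root_of_unity n q"
    and "l = lcm m n"
    and "\<mu> \<noteq> 0" and "lam \<noteq> 0" and "\<gamma> \<noteq> 0"
  shows "simple_right_module (H_alg p q) (V1 p q l \<mu> lam \<gamma>) \<and>
         fs.dim (carrier (V1 p q l \<mu> lam \<gamma>)) = l"
proof
  have "0 < l"
    using assms by (simp add: primitive_root_of_unity_def lcm_pos_nat)
  moreover have "p ^ l = 1" "q ^ l = 1"
    using assms by (auto intro: primitive_root_of_unity_power_eq_1)
  \<comment> \<open>The separation hypothesis on indices below \<open>l\<close> is where
    \<open>l\<close> being the lcm of the exact orders enters.\<close>
  ultimately show "simple_right_module (H_alg p q) (V1 p q l \<mu> lam \<gamma>)"
    using assms primitive_roots_of_unity_separate[OF assms(4,5)]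
    by (intro simple_right_module_V1) auto
  show "fs.dim (carrier (V1 p q l \<mu> lam \<gamma>)) = l"
    by (rule dim_V1)
qed

end
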